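(* Let $k\in\{1,\dots,K\}$, and let $f_{\mathrm{SINR}_k}:\mathbb{C}^{N\tau}\to\mathbb{R}$ be the radar SINR function $$f_{\mathrm{SINR}_k}(\mathbf{x})=\sigma_k^2\,\mathbf{x}^{\mathrm H}\mathbf{B}_k^{\mathrm H}\mathbf{C}_k^{-1}\mathbf{B}_k\mathbf{x},\qquad \mathbf{C}_k=\mathbf{C}_k(\mathbf{x})=\sum_{i\in\mathcal{L},\,i\ne \ell_k}\sigma_i^2\mathbf{B}_i\mathbf{x}\mathbf{x}^{\mathrm H}\mathbf{B}_i^{\mathrm H}+\sigma_{\mathrm r}^2\mathbf{I}.$$ Then for every $\mathbf{x}\in\mathbb{C}^{N\tau}$ the Euclidean gradient of $f_{\mathrm{SINR}_k}$ with respect to $\mathbf{x}$ is $$\nabla f_{\mathrm{SINR}_k}(\mathbf{x})=\sigma_k^2\Big(\mathbf{B}_k^{\mathrm H}-\sum_{i\in\mathcal{L},\,i\neq \ell_k}\sigma_i^2\big(\mathbf{x}^{\mathrm H}\mathbf{B}_k^{\mathrm H}\mathbf{C}_k^{-1}\mathbf{B}_i\mathbf{x}\big)\mathbf{B}_i^{\mathrm H}\Big)\mathbf{C}_k^{-1}\mathbf{B}_k\mathbf{x}.$$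
   Context: $N,\tau,K,L\ge1$ are integers and $\mathcal{L}=\{1,\dots,L\}$ indexes a finite set of angles (targets and clutter). For each $i\in\mathcal{L}$ there are a steering vector $\mathbf{a}_i\in\mathbb{C}^N$, a variance $\sigma_i^2\ge 0$, and the matrix $\mathbf{B}_i=\mathbf{I}_\tau\otimes(\mathbf{a}_i\mathbf{a}_i^{\mathrm H})\in\mathbb{C}^{N\tau\times N\tau}$. Target $k$ is located at the angle with index $\ell_k\in\mathcal{L}$; the symbols $\mathbf{B}_k$ and $\sigma_k^2$ for target $k$ mean the quantities $\mathbf{B}_{\ell_k}$ and $\sigma_{\ell_k}^2$ attached to that angle. The noise variance satisfies $\sigma_{\mathrm r}^2>0$. Here $\otimes$ is the Kronecker product and $(\cdot)^{\mathrm H}$ the conjugate transpose. Convention: for a real-valued function $f$ of a complex vector $\mathbf{x}$, the Euclidean gradient is the column vector of Wirtinger derivatives $\nabla f(\mathbf{x})=\partial f/\partial\mathbf{x}^{\mathrm H}$, with $n$-th entry $\partial f/\partial x_n^*=\frac12\big(\partial f/\partial \Re x_n+\mathrm{j}\,\partial f/\partial\Im x_n\big)$, where $\mathrm{j}$ is the imaginary unit. Equivalently, the real differential of $f$ is $df=(d\mathbf{x})^{\mathrm H}\nabla f(\mathbf{x})+\nabla f(\mathbf{x})^{\mathrm H}d\mathbf{x}$. *)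

theory Defs
  imports "HOL-Analysis.Analysis"
begin

section \<open>Complex matrices and vectors\<close>

definition herm :: "complex^'n^'m \<Rightarrow> complex^'m^'n"
  where "herm A = (\<chi> i j. cnj (A $ j $ i))"

text \<open>\<open>cdot x y\<close> is $x^{\mathrm H} y$ (conjugate-linear in the first argument) and
  \<open>outer x y\<close> is $x y^{\mathrm H}$.\<close>

definition cdot :: "complex^'n \<Rightarrow> complex^'n \<Rightarrow> complex"
  where "cdot x y = (\<Sum>i\<in>UNIV. cnj (x $ i) * y $ i)"

definition outer :: "complex^'m \<Rightarrow> complex^'n \<Rightarrow> complex^'n^'m"
  where "outer x y = (\<chi> i j. x $ i * cnj (y $ j))"

definition mscale :: "complex \<Rightarrow> complex^'n^'m \<Rightarrow> complex^'n^'m"  (infixr \<open>*m\<close> 75)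
  where "c *m A = (\<chi> i j. c * A $ i $ j)"

text \<open>The rows and columns of a Kronecker product are indexed by pairs; in the lexicographic
  order of the pairs this is the usual block matrix with blocks \<open>A $ i $ j\<close> times \<open>B\<close>.\<close>

definition kron :: "complex^'n^'m \<Rightarrow> complex^'q^'p \<Rightarrow> complex^('n \<times> 'q)^('m \<times> 'p)"
  where "kron A B = (\<chi> r s. A $ fst r $ fst s * B $ snd r $ snd s)"

section \<open>The Wirtinger gradient of a real-valued function\<close>

text \<open>The entry at \<open>n\<close> is $\partial f/\partial x_n^* =
  \frac12 (\partial f/\partial \Re x_n + \mathrm{j}\,\partial f/\partial \Im x_n)$. The derivatives
  are only meaningful where they exist, so statements about \<open>wgrad f x\<close> should come with
  differentiability of \<open>f\<close> at \<open>x\<close>.\<close>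

definition wgrad :: "(complex^'m \<Rightarrow> real) \<Rightarrow> complex^'m \<Rightarrow> complex^'m"
  where "wgrad f x = (\<chi> n. (1/2) *
    (complex_of_real (deriv (\<lambda>t::real. f (x + t *\<^sub>R axis n 1)) 0)
      + \<i> * complex_of_real (deriv (\<lambda>t::real. f (x + t *\<^sub>R axis n \<i>)) 0)))"

lemma cdot_commute: "cdot y x = cnj (cdot x y)"
  by (simp add: cdot_def mult.commute)

lemma cdot_add_right: "cdot x (y + z) = cdot x y + cdot x z"
  by (simp add: cdot_def algebra_simps sum.distrib)

lemma cdot_scaleR_right: "cdot x (c *\<^sub>R y) = c *\<^sub>R cdot x y"
  by (simp add: cdot_def scaleR_right.sum)

lemma cdot_sum_right: "cdot x (sum f A) = (\<Sum>i\<in>A. cdot x (f i))"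
  by (induction A rule: infinite_finite_induct) (simp_all add: cdot_add_right, simp_all add: cdot_def)

lemma inner_complex_vec: "2 * (g \<bullet> h) = Re (cdot h g + cdot g h)"
  for g h :: "complex^'m"
  by (simp add: inner_vec_def cdot_def inner_complex_def sum.distrib[symmetric] sum_distrib_left
      algebra_simps)

lemma wgrad_unique:
  fixes f :: "complex^'m \<Rightarrow> real"
  assumes "(f has_derivative (\<lambda>h. 2 * (g \<bullet> h))) (at x)"
  shows "wgrad f x = g"
proof -
  have line: "deriv (\<lambda>t::real. f (x + t *\<^sub>R v)) 0 = 2 * (g \<bullet> v)" for v
  proof (rule DERIV_imp_deriv)
    have "((\<lambda>t::real. x + t *\<^sub>R v) has_derivative (\<lambda>t. t *\<^sub>R v)) (at 0)"
      by (auto intro!: derivative_eq_intros)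
    moreover have "(f has_derivative (\<lambda>h. 2 * (g \<bullet> h))) (at (x + (0::real) *\<^sub>R v))"
      using assms by simp
    ultimately have "((\<lambda>t::real. f (x + t *\<^sub>R v)) has_derivative (\<lambda>t. 2 * (g \<bullet> (t *\<^sub>R v)))) (at 0)"
      by (rule has_derivative_compose)
    then show "((\<lambda>t::real. f (x + t *\<^sub>R v)) has_real_derivative 2 * (g \<bullet> v)) (at 0)"
      by (simp add: has_field_derivative_def mult.commute mult.left_commute mult_commute_abs)
  qed
  show ?thesis
    by (simp add: wgrad_def line vec_eq_iff inner_axis inner_complex_def complex_eq_iff)
qed

text \<open>The equivalent description by the real differential
  $df = (dx)^{\mathrm H} g + g^{\mathrm H} dx$.\<close>

lemma wgrad_iff:
  fixes f :: "complex^'m \<Rightarrow> real"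
  shows "f differentiable (at x) \<and> wgrad f x = g \<longleftrightarrow>
    (f has_derivative (\<lambda>h. Re (cdot h g + cdot g h))) (at x)"
proof
  assume "(f has_derivative (\<lambda>h. Re (cdot h g + cdot g h))) (at x)"
  then have d: "(f has_derivative (\<lambda>h. 2 * (g \<bullet> h))) (at x)"
    by (simp add: inner_complex_vec)
  then show "f differentiable (at x) \<and> wgrad f x = g"
    using wgrad_unique[OF d] by (auto simp: differentiable_def)
next
  assume asm: "f differentiable (at x) \<and> wgrad f x = g"
  then obtain D where D: "(f has_derivative D) (at x)"
    by (auto simp: differentiable_def)
  interpret D: bounded_linear D using D by (rule has_derivative_bounded_linear)
  define g' where "g' = (1/2) *\<^sub>R (\<Sum>b\<in>Basis. D b *\<^sub>R b)"
  have "D h = 2 * (g' \<bullet> h)" for h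
  proof -
    have "D h = D (\<Sum>b\<in>Basis. (h \<bullet> b) *\<^sub>R b)" by (simp add: euclidean_representation)
    also have "\<dots> = (\<Sum>b\<in>Basis. (h \<bullet> b) * D b)"
      by (simp add: D.sum D.scaleR)
    also have "\<dots> = 2 * (g' \<bullet> h)"
      by (simp add: g'_def inner_commute[of _ h] inner_sum_right mult.commute)
    finally show ?thesis .
  qed
  then have "D = (\<lambda>h. 2 * (g' \<bullet> h))" by auto
  with D have D': "(f has_derivative (\<lambda>h. 2 * (g' \<bullet> h))) (at x)" by simp
  with wgrad_unique[OF D'] asm show "(f has_derivative (\<lambda>h. Re (cdot h g + cdot g h))) (at x)"
    by (simp add: inner_complex_vec)
qed

section \<open>The radar SINR\<close>

text \<open>With \<open>'n\<close> the antennas and \<open>'t\<close> the time slots, a waveform in $\mathbb{C}^{N\tau}$ has type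
  \<^typ>\<open>complex^('t::finite \<times> 'n)\<close>.\<close>

definition angle_mat :: "complex^'n \<Rightarrow> complex^('t::finite \<times> 'n)^('t::finite \<times> 'n)"
  where "angle_mat a = kron (mat 1 :: complex^'t::finite^'t) (outer a a)"

text \<open>Angles are indexed by \<open>{1..L}\<close>, \<open>v i\<close> is the variance $\sigma_i^2$ (not the standard
  deviation), \<open>vr\<close> is $\sigma_{\mathrm r}^2$, and \<open>l\<close> is the angle of the target considered.\<close>

definition cov ::
  "nat \<Rightarrow> (nat \<Rightarrow> complex^'n) \<Rightarrow> (nat \<Rightarrow> real) \<Rightarrow> real \<Rightarrow> nat \<Rightarrow>
    complex^('t::finite \<times> 'n) \<Rightarrow> complex^('t::finite \<times> 'n)^('t::finite \<times> 'n)"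
  where "cov L a v vr l x =
    (\<Sum>i\<in>{1..L} - {l}. v i *\<^sub>R (angle_mat (a i) ** outer x x ** herm (angle_mat (a i))))
      + vr *\<^sub>R mat 1"

text \<open>The quadratic form below is real (see \<open>of_real_sinr\<close>), so \<open>Re\<close> only changes the type.\<close>

definition sinr ::
  "nat \<Rightarrow> (nat \<Rightarrow> complex^'n) \<Rightarrow> (nat \<Rightarrow> real) \<Rightarrow> real \<Rightarrow> nat \<Rightarrow> complex^('t::finite \<times> 'n) \<Rightarrow> real"
  where "sinr L a v vr l x = v l *
    Re (cdot x ((herm (angle_mat (a l)) ** matrix_inv (cov L a v vr l x) ** angle_mat (a l)) *v x))"

lemma herm_herm: "herm (herm A) = A"
  by (simp add: herm_def vec_eq_iff)

lemma herm_matrix_mult: "herm (A ** B) = herm B ** herm A"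
  by (simp add: herm_def vec_eq_iff matrix_matrix_mult_def mult.commute)

lemma herm_add: "herm (A + B) = herm A + herm B"
  by (simp add: herm_def vec_eq_iff)

lemma herm_scaleR: "herm (c *\<^sub>R A) = c *\<^sub>R herm A"
  by (simp add: herm_def vec_eq_iff)

lemma herm_sum: "herm (sum f S) = (\<Sum>i\<in>S. herm (f i))"
  by (induction S rule: infinite_finite_induct) (simp_all add: herm_add, simp_all add: herm_def vec_eq_iff)

lemma herm_mat_1: "herm (mat 1) = mat 1"
  by (simp add: herm_def vec_eq_iff mat_def)

lemma herm_outer: "herm (outer x y) = outer y x"
  by (simp add: herm_def outer_def vec_eq_iff mult.commute)

lemma outer_mult_vec: "outer x y *v z = cdot y z *s x"
  by (simp add: outer_def cdot_def vec_eq_iff matrix_vector_mult_def sum_distrib_left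
      sum_distrib_right mult_ac)

lemma cdot_herm: "cdot x (A *v y) = cdot (herm A *v x) y"
proof -
  have "cdot x (A *v y) = (\<Sum>i\<in>UNIV. \<Sum>j\<in>UNIV. cnj (x $ i) * (A $ i $ j * y $ j))"
    by (simp add: cdot_def matrix_vector_mult_def sum_distrib_left)
  also have "\<dots> = (\<Sum>j\<in>UNIV. \<Sum>i\<in>UNIV. cnj (x $ i) * (A $ i $ j * y $ j))"
    by (rule sum.swap)
  also have "\<dots> = cdot (herm A *v x) y"
    by (simp add: cdot_def matrix_vector_mult_def herm_def sum_distrib_left mult_ac)
  finally show ?thesis .
qed

lemma cdot_scale_right: "cdot x (c *s y) = c * cdot x y"
  by (simp add: cdot_def sum_distrib_left mult_ac)

lemma cdot_self: "cdot x x = complex_of_real ((norm x)\<^sup>2)"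
proof (rule complex_eqI)
  show "Re (cdot x x) = Re (complex_of_real ((norm x)\<^sup>2))"
    using inner_complex_vec[of x x] by (simp add: power2_norm_eq_inner)
  show "Im (cdot x x) = Im (complex_of_real ((norm x)\<^sup>2))"
    by (simp add: cdot_def mult.commute)
qed

lemma herm_cov: "herm (cov L a v vr l x) = cov L a v vr l x"
  by (simp add: cov_def herm_add herm_sum herm_scaleR herm_matrix_mult herm_mat_1 herm_outer
      herm_herm matrix_mul_assoc)

lemma sum_matrix_vector_mult: "sum f S *v y = (\<Sum>i\<in>S. f i *v y)"
  for f :: "'i \<Rightarrow> complex^'n^'m"
  by (induction S rule: infinite_finite_induct) (simp_all add: matrix_vector_mult_add_rdistrib)

lemma scaleR_matrix_vector: "(c *\<^sub>R A) *v y = c *\<^sub>R (A *v y)"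
  for A :: "complex^'n^'m"
  by (simp add: vec_eq_iff matrix_vector_mult_def scaleR_right.sum)

lemma cdot_cov:
  fixes a :: "nat \<Rightarrow> complex^'n" and x y :: "complex^('t::finite \<times> 'n)"
  shows
  "Re (cdot y (cov L a v vr l x *v y)) =
    (\<Sum>i\<in>{1..L} - {l}. v i * (cmod (cdot (angle_mat (a i) *v x) y))\<^sup>2) + vr * (norm y)\<^sup>2"
proof -
  have "Re (cdot y ((angle_mat (a i) ** outer x x ** herm (angle_mat (a i))) *v y)) =
      (cmod (cdot (angle_mat (a i) *v x) y))\<^sup>2" for i
  proof -
    let ?B = "angle_mat (a i) :: complex^('t \<times> 'n)^('t \<times> 'n)"
    have *: "cdot x (herm ?B *v y) = cdot (?B *v x) y"
      using cdot_herm[of x "herm ?B" y] by (simp add: herm_herm)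
    have "cdot y ((?B ** outer x x ** herm ?B) *v y) = cdot (herm ?B *v y) (cdot (?B *v x) y *s x)"
      by (simp add: matrix_vector_mul_assoc[symmetric] outer_mult_vec cdot_herm[of y] *)
    also have "\<dots> = cdot (?B *v x) y * cnj (cdot (?B *v x) y)"
      by (simp add: cdot_scale_right cdot_commute[of "herm ?B *v y" x] *)
    finally show ?thesis by (simp add: complex_mult_cnj cmod_power2)
  qed
  then show ?thesis
    by (simp add: cov_def matrix_vector_mult_add_rdistrib sum_matrix_vector_mult cdot_add_right
        cdot_sum_right scaleR_matrix_vector cdot_scaleR_right cdot_self)
qed

lemma invertible_cov:
  assumes "\<And>i. i \<in> {1..L} \<Longrightarrow> v i \<ge> 0" and "vr > 0"
  shows "invertible (cov L a v vr l x)"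
proof -
  have "y = 0" if "cov L a v vr l x *v y = 0" for y
  proof -
    have "(\<Sum>i\<in>{1..L} - {l}. v i * (cmod (cdot (angle_mat (a i) *v x) y))\<^sup>2) + vr * (norm y)\<^sup>2 = 0"
      using cdot_cov[of y L a v vr l x] that by (simp add: cdot_def)
    moreover have "(\<Sum>i\<in>{1..L} - {l}. v i * (cmod (cdot (angle_mat (a i) *v x) y))\<^sup>2) \<ge> 0"
      using assms(1) by (intro sum_nonneg) auto
    ultimately have "vr * (norm y)\<^sup>2 \<le> 0" by linarith
    then show "y = 0" using assms(2) by (simp add: mult_le_0_iff)
  qed
  then show ?thesis
    by (simp add: invertible_left_inverse matrix_left_invertible_ker)
qed

lemma herm_matrix_inv:
  assumes "invertible A"
  shows "herm (matrix_inv A) = matrix_inv (herm A)"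
proof -
  have "A ** matrix_inv A = mat 1 \<and> matrix_inv A ** A = mat 1"
    using someI_ex[OF assms[unfolded invertible_def]] by (simp add: matrix_inv_def)
  then have 1: "herm (matrix_inv A) ** herm A = mat 1" "herm A ** herm (matrix_inv A) = mat 1"
    by (metis herm_matrix_mult herm_mat_1)+
  then have "invertible (herm A)" by (auto simp: invertible_def)
  from someI_ex[OF this[unfolded invertible_def]]
  have "herm A ** matrix_inv (herm A) = mat 1" by (simp add: matrix_inv_def)
  with 1 show ?thesis by (metis matrix_mul_assoc matrix_mul_lid matrix_mul_rid)
qed

lemma of_real_sinr:
  assumes "\<And>i. i \<in> {1..L} \<Longrightarrow> v i \<ge> 0" and "vr > 0"
  shows "complex_of_real (sinr L a v vr l x) = complex_of_real (v l) *
    cdot x ((herm (angle_mat (a l)) ** matrix_inv (cov L a v vr l x) ** angle_mat (a l)) *v x)"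
proof -
  let ?M = "herm (angle_mat (a l)) ** matrix_inv (cov L a v vr l x) ** angle_mat (a l)"
  have "herm ?M = ?M"
    using herm_matrix_inv[OF invertible_cov[where a = a and l = l and x = x, OF assms]]
    by (simp add: herm_matrix_mult herm_herm herm_cov matrix_mul_assoc)
  then have "cnj (cdot x (?M *v x)) = cdot x (?M *v x)"
    using cdot_herm[of x ?M x] cdot_commute[of "?M *v x" x] by simp
  then have "complex_of_real (Re (cdot x (?M *v x))) = cdot x (?M *v x)"
    by (simp add: complex_eq_iff)
  then show ?thesis by (simp add: sinr_def)
qed

end

theory Submission
  imports Defs
begin

text \<open>No derivative of the matrix inverse is needed. With \<open>u y = B\<^sub>l y\<close> and the fixed vector
  \<open>w = C(x)\<inverse> u x\<close>, the form \<open>u y \<bullet> C(y)\<inverse> u y\<close> differs from the polynomial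
  \<open>2 (w \<bullet> u y) - w \<bullet> C(y) w\<close> by \<open>r \<bullet> C(y)\<inverse> r\<close>, where \<open>r = u y - C(y) w\<close> vanishes at \<open>x\<close>.
  Since \<open>C(y)\<close> is bounded below by the noise variance, the difference is quadratically small,
  and both functions have the same derivative at \<open>x\<close>.\<close>

lemma Re_cdot: "Re (cdot x y) = x \<bullet> y"
  using inner_complex_vec[of x y] cdot_commute[of x y] by simp

lemma inner_matrix_vector: "x \<bullet> (A *v y) = (herm A *v x) \<bullet> y"
  for A :: "complex^'n^'m"
  by (metis Re_cdot cdot_herm)

text \<open>Conjugation is linear over the reals, so both slots are real-linear, and finite
  dimension supplies the bound.\<close>

lemma bounded_bilinear_cdot: "bounded_bilinear cdot"
proof -
  have "bilinear (cdot :: complex^'n \<Rightarrow> complex^'n \<Rightarrow> complex)"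
    by (auto simp: bilinear_def cdot_def algebra_simps sum.distrib scaleR_right.sum intro!: linearI)
  then show ?thesis
    using bilinear_conv_bounded_bilinear by blast
qed

lemma bounded_bilinear_vector_scalar_mult:
  "bounded_bilinear ((*s) :: complex \<Rightarrow> complex^'n \<Rightarrow> complex^'n)"
proof -
  have "bilinear ((*s) :: complex \<Rightarrow> complex^'n \<Rightarrow> complex^'n)"
    by (auto simp: bilinear_def vec_eq_iff algebra_simps intro!: linearI)
  then show ?thesis
    using bilinear_conv_bounded_bilinear by blast
qed

lemma bounded_linear_matrix_vector: "bounded_linear ((*v) (A :: complex^'n^'m))"
  by (intro linear_conv_bounded_linear[THEN iffD1] linearI)
    (simp_all add: vec_eq_iff matrix_vector_mult_def algebra_simps sum.distrib scaleR_right.sum)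

text \<open>By the product rule \<open>r y \<bullet> r y\<close> has derivative zero where
  \<open>r\<close> vanishes. The bound then forces \<open>f\<close> and \<open>g\<close> to agree at
  \<open>x\<close> and makes \<open>f - g\<close> of smaller order than
  \<open>norm (y - x)\<close>.\<close>

lemma has_derivative_quadratic_error:
  fixes f g :: "'a::real_normed_vector \<Rightarrow> real" and r :: "'a \<Rightarrow> 'b::real_inner"
  assumes g: "(g has_derivative g') (at x)" and r: "(r has_derivative r') (at x)" "r x = 0"
    and bound: "\<And>y. \<bar>f y - g y\<bar> \<le> c * (norm (r y))\<^sup>2"
  shows "(f has_derivative g') (at x)"
proof -
  have "((\<lambda>y. r y \<bullet> r y) has_derivative (\<lambda>h. 0)) (at x)"
    using has_derivative_inner[OF r(1) r(1)] r(2) by simp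
  then have "((\<lambda>y. c * (norm (r y))\<^sup>2) has_derivative (\<lambda>h. 0)) (at x)"
    using has_derivative_mult_right[of _ "\<lambda>h. 0" _ c] by (simp add: power2_norm_eq_inner)
  then have 1: "(\<lambda>y. c * (norm (r y))\<^sup>2 / norm (y - x)) \<midarrow>x\<rightarrow> 0"
    using r(2) by (simp add: has_derivative_at_within divide_inverse mult.commute)
  have "f x = g x"
    using bound[of x] r(2) by simp
  moreover have "(\<lambda>y. (f y - g y) / norm (y - x)) \<midarrow>x\<rightarrow> 0"
    by (rule Lim_null_comparison[OF _ 1]) (auto intro!: always_eventually divide_right_mono bound)
  ultimately have "((\<lambda>y. f y - g y) has_derivative (\<lambda>h. 0)) (at x)"
    by (simp add: has_derivative_at_within divide_inverse mult.commute)
  from has_derivative_add[OF g this] show ?thesis by simp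
qed

lemma matrix_inv_vector:
  fixes A :: "complex^'n^'n"
  assumes "invertible A"
  shows "A *v (matrix_inv A *v y) = y" "matrix_inv A *v (A *v y) = y"
proof -
  have "A ** matrix_inv A = mat 1 \<and> matrix_inv A ** A = mat 1"
    using someI_ex[OF assms[unfolded invertible_def]] by (simp add: matrix_inv_def)
  then show "A *v (matrix_inv A *v y) = y" "matrix_inv A *v (A *v y) = y"
    by (simp_all add: matrix_vector_mul_assoc)
qed

text \<open>Completing the square: with residual \<open>r = u - A *v w\<close> and
  \<open>z = matrix_inv A *v r\<close>, the difference is exactly \<open>r \<bullet> z\<close>, and
  coercivity controls \<open>z\<close> by \<open>r\<close>.\<close>

lemma inverse_form_residual:
  fixes A :: "complex^'n^'n"
  assumes herm: "herm A = A" and inv: "invertible A"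
    and c: "c > 0" and coercive: "\<And>z. c * (norm z)\<^sup>2 \<le> z \<bullet> (A *v z)"
  shows "\<bar>u \<bullet> (matrix_inv A *v u) - (2 * (w \<bullet> u) - w \<bullet> (A *v w))\<bar> \<le> (norm (u - A *v w))\<^sup>2 / c"
proof -
  define r where "r = u - A *v w"
  define z where "z = matrix_inv A *v r"
  have Az: "A *v z = r"
    by (simp add: z_def matrix_inv_vector inv)
  have z: "z = matrix_inv A *v u - w"
    by (simp add: z_def r_def matrix_vector_mult_diff_distrib matrix_inv_vector inv)
  \<comment> \<open>Self-adjointness makes the two cross terms in the expansion of
    \<open>r \<bullet> z\<close> equal.\<close>
  have "w \<bullet> u = (A *v w) \<bullet> (matrix_inv A *v u)"
    using inner_matrix_vector[of w A "matrix_inv A *v u"] by (simp add: herm matrix_inv_vector inv)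
  then have eq: "u \<bullet> (matrix_inv A *v u) - (2 * (w \<bullet> u) - w \<bullet> (A *v w)) = r \<bullet> z"
    by (simp add: z r_def inner_diff inner_commute)
  \<comment> \<open>Coercivity is tested at \<open>z\<close>, where \<open>A *v z = r\<close>;
    cancelling one factor \<open>norm z\<close> gives the bound.\<close>
  have "c * (norm z)\<^sup>2 \<le> norm z * norm r"
    using coercive[of z] norm_cauchy_schwarz[of z r] by (simp add: Az)
  then have "norm z \<le> norm r / c"
    using c by (cases "z = 0") (simp_all add: power2_eq_square field_simps)
  then have "norm r * norm z \<le> norm r * (norm r / c)"
    by (rule mult_left_mono) simp
  with Cauchy_Schwarz_ineq2[of r z] show ?thesis
    by (simp add: eq power2_eq_square flip: r_def)
qed

text \<open>Each clutter term is the rank-one matrix built from \<open>angle_mat (a i) *v x\<close>.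
  For fixed \<open>w\<close> this exhibits the product as a vector-valued quadratic polynomial in
  \<open>x\<close>, to which the product rule applies directly.\<close>

lemma cov_mult_vec:
  fixes a :: "nat \<Rightarrow> complex^'n" and x w :: "complex^('t::finite \<times> 'n)"
  shows "cov L a v vr l x *v w =
    (\<Sum>i\<in>{1..L} - {l}. v i *\<^sub>R (cdot (angle_mat (a i) *v x) w *s (angle_mat (a i) *v x)))
      + vr *\<^sub>R w"
proof -
  have "(angle_mat (a i) ** outer x x ** herm (angle_mat (a i))) *v w =
      cdot (angle_mat (a i) *v x) w *s (angle_mat (a i) *v x)" for i
    using cdot_herm[of x "herm (angle_mat (a i))" w]
    by (simp add: matrix_vector_mul_assoc[symmetric] outer_mult_vec herm_herm vector_scalar_commute)
  then show ?thesis
    by (simp add: cov_def matrix_vector_mult_add_rdistrib sum_matrix_vector_mult scaleR_matrix_vector)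
qed

text \<open>The differential is put in the form \<open>2 * (G \<bullet> h)\<close>, from which
  \<open>wgrad_unique\<close> reads off the gradient \<open>G\<close>.\<close>

lemma sinr_has_derivative:
  fixes l :: nat and a :: "nat \<Rightarrow> complex^'n" and x :: "complex^('t::finite \<times> 'n)"
  assumes v: "\<And>i. i \<in> {1..L} \<Longrightarrow> v i \<ge> 0" and vr: "vr > 0"
  defines "B \<equiv> (\<lambda>i. angle_mat (a i) :: complex^('t \<times> 'n)^('t \<times> 'n))"
  defines "w \<equiv> matrix_inv (cov L a v vr l x) *v (B l *v x)"
  shows "(sinr L a v vr l has_derivative (\<lambda>h. 2 * ((v l *\<^sub>R (herm (B l) *v w -
    (\<Sum>i\<in>{1..L} - {l}. v i *\<^sub>R (cdot w (B i *v x) *s (herm (B i) *v w))))) \<bullet> h))) (at x)"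
proof -
  let ?I = "{1..L} - {l}"
  let ?C = "cov L a v vr l"
  have inv: "invertible (?C y)" for y
    by (rule invertible_cov) (use v vr in auto)
  have B_app: "angle_mat (a i) = B i" for i
    by (simp add: B_def)
  have B: "((\<lambda>y. B i *v y) has_derivative (\<lambda>h. B i *v h)) (at x)" for i
    by (rule bounded_linear_imp_has_derivative[OF bounded_linear_matrix_vector])
  have cdB: "((\<lambda>y. cdot (B i *v y) w) has_derivative (\<lambda>h. cdot (B i *v h) w)) (at x)" for i
    by (rule bounded_linear.has_derivative[OF
          bounded_bilinear.bounded_linear_left[OF bounded_bilinear_cdot] B])
  \<comment> \<open>The vector \<open>w\<close> stays frozen at its value for \<open>x\<close> while
    \<open>y\<close> varies, so \<open>g\<close> involves no inverse of a varying matrix.\<close>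
  define g where "g y = 2 * (w \<bullet> (B l *v y)) - w \<bullet> (?C y *v w)" for y
  define r where "r y = B l *v y - ?C y *v w" for y
  have g_eq: "g = (\<lambda>y. 2 * (w \<bullet> (B l *v y)) -
      ((\<Sum>i\<in>?I. v i * (cdot (B i *v y) w \<bullet> cdot (B i *v y) w)) + vr * (norm w)\<^sup>2))"
    using cdot_cov[of w L a v vr l] by (simp add: g_def Re_cdot B_def power2_norm_eq_inner fun_eq_iff)
  have g': "(g has_derivative (\<lambda>h. 2 * (w \<bullet> (B l *v h)) -
      (\<Sum>i\<in>?I. v i * (2 * (cdot (B i *v x) w \<bullet> cdot (B i *v h) w))))) (at x)"
    unfolding g_eq
    by (auto intro!: derivative_eq_intros B cdB simp: inner_commute)
  have quad: "((\<lambda>y. cdot (B i *v y) w *s (B i *v y)) has_derivative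
      (\<lambda>h. cdot (B i *v x) w *s (B i *v h) + cdot (B i *v h) w *s (B i *v x))) (at x)" for i
    by (rule bounded_bilinear.FDERIV[OF bounded_bilinear_vector_scalar_mult cdB B])
  \<comment> \<open>The residual enters only through its squared norm, so differentiability at
    \<open>x\<close> suffices. The summand \<open>0\<close> comes from the constant noise term
    \<open>vr *\<^sub>R w\<close>.\<close>
  obtain r' where r': "(r has_derivative r') (at x)"
  proof
    show "(r has_derivative (\<lambda>h. B l *v h - ((\<Sum>i\<in>?I. v i *\<^sub>R
        (cdot (B i *v x) w *s (B i *v h) + cdot (B i *v h) w *s (B i *v x))) + 0))) (at x)"
      unfolding r_def cov_mult_vec B_app
      by (intro has_derivative_diff has_derivative_add has_derivative_sum
          has_derivative_scaleR_right has_derivative_const B quad)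
  qed
  have "r x = 0"
    by (simp add: r_def w_def matrix_inv_vector inv)
  \<comment> \<open>The clutter contributes nonnegative squares, so \<open>vr\<close> is a lower
    bound uniform in \<open>y\<close>; hence the single constant \<open>1 / vr\<close>
    below.\<close>
  have coercive: "vr * (norm z)\<^sup>2 \<le> z \<bullet> (?C y *v z)" for y z
    using v by (auto simp: cdot_cov simp flip: Re_cdot intro!: sum_nonneg)
  have "\<bar>(B l *v y) \<bullet> (matrix_inv (?C y) *v (B l *v y)) - g y\<bar> \<le> (1 / vr) * (norm (r y))\<^sup>2" for y
    using inverse_form_residual[OF herm_cov inv vr coercive] by (simp add: g_def r_def)
  note q' = has_derivative_mult_right[OF
      has_derivative_quadratic_error[OF g' r' \<open>r x = 0\<close> this], of "v l"]
  have sinr_eq: "sinr L a v vr l = (\<lambda>y. v l * ((B l *v y) \<bullet> (matrix_inv (?C y) *v (B l *v y))))"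
    by (simp add: fun_eq_iff sinr_def Re_cdot B_app inner_matrix_vector herm_herm
        matrix_vector_mul_assoc[symmetric])
  \<comment> \<open>The real inner product of complex numbers conjugates its first factor, which
    turns \<open>cdot (B i *v x) w\<close> into \<open>cdot w (B i *v x)\<close>. Taking the adjoint
    of \<open>B i\<close> then isolates \<open>h\<close>.\<close>
  have "cdot (B i *v x) w \<bullet> cdot (B i *v h) w =
      (cdot w (B i *v x) *s (herm (B i) *v w)) \<bullet> h" for i h
  proof -
    have "(cdot w (B i *v x) *s (herm (B i) *v w)) \<bullet> h =
        Re (cdot w (B i *v x) * cdot (B i *v h) w)"
      using cdot_herm[of h "herm (B i)" w]
      by (metis Re_cdot cdot_scale_right herm_herm inner_commute)
    then show ?thesis
      by (simp add: cdot_commute[of w] inner_complex_def)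
  qed
  then show ?thesis
    unfolding sinr_eq
    by (intro has_derivative_eq_rhs[OF q'])
      (simp add: fun_eq_iff inner_matrix_vector inner_diff_left inner_sum_left sum_distrib_left
        right_diff_distrib mult_ac)
qed

theorem lemma1:
  fixes K L k :: nat
    and a :: "nat \<Rightarrow> complex^'n"
    and \<sigma>2 :: "nat \<Rightarrow> real"
    and \<sigma>r2 :: real
    and loc :: "nat \<Rightarrow> nat"
    and x :: "complex^('t::finite \<times> 'n)"
  assumes "K \<ge> 1" and "L \<ge> 1"
    and "\<And>i. i \<in> {1..L} \<Longrightarrow> \<sigma>2 i \<ge> 0"
    and "\<sigma>r2 > 0"
    and "\<And>j. j \<in> {1..K} \<Longrightarrow> loc j \<in> {1..L}"
    and "k \<in> {1..K}"
  shows "(sinr L a \<sigma>2 \<sigma>r2 (loc k) :: complex^('t::finite \<times> 'n) \<Rightarrow> real) differentiable (at x) \<and>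
    wgrad (sinr L a \<sigma>2 \<sigma>r2 (loc k)) x =
      \<sigma>2 (loc k) *\<^sub>R
        ((herm (angle_mat (a (loc k)))
          - (\<Sum>i\<in>{1..L} - {loc k}. \<sigma>2 i *\<^sub>R
              (cdot x ((herm (angle_mat (a (loc k))) ** matrix_inv (cov L a \<sigma>2 \<sigma>r2 (loc k) x)
                  ** angle_mat (a i)) *v x)
                *m herm (angle_mat (a i)))))
         *v ((matrix_inv (cov L a \<sigma>2 \<sigma>r2 (loc k) x) ** angle_mat (a (loc k))) *v x))"
proof -
  let ?C = "cov L a \<sigma>2 \<sigma>r2 (loc k) x"
  let ?B = "\<lambda>i. angle_mat (a i) :: complex^('t \<times> 'n)^('t \<times> 'n)"
  let ?w = "matrix_inv ?C *v (?B (loc k) *v x)"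
  note D = sinr_has_derivative[where L = L and v = \<sigma>2 and a = a and l = "loc k" and x = x,
      OF _ \<open>\<sigma>r2 > 0\<close>, OF assms(3)]
  \<comment> \<open>The inverse covariance is Hermitian, so it can be moved to the left slot of
    \<open>cdot\<close>; this identifies the scalar coefficients of the claimed formula with
    \<open>cdot ?w (?B i *v x)\<close>.\<close>
  have "herm (matrix_inv ?C) = matrix_inv ?C"
    using herm_matrix_inv[OF invertible_cov[where L = L and v = \<sigma>2 and a = a and l = "loc k" and x = x, OF assms(3,4)]]
    by (simp add: herm_cov)
  then have coeff: "cdot x (herm (?B (loc k)) *v (matrix_inv ?C *v (?B i *v x))) =
      cdot ?w (?B i *v x)" for i
    by (simp add: cdot_herm herm_herm)
  have mscale: "(c *m A) *v y = c *s (A *v y)" for c y and A :: "complex^('t \<times> 'n)^('t \<times> 'n)"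
    by (simp add: mscale_def vec_eq_iff matrix_vector_mult_def sum_distrib_left mult.assoc)
  show ?thesis
    using D wgrad_unique[OF D]
    by (auto simp: differentiable_def coeff matrix_vector_mult_diff_rdistrib sum_matrix_vector_mult
        scaleR_matrix_vector mscale matrix_vector_mul_assoc[symmetric])
qed

end
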